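(* Let $n>1$ be an odd integer. Then \[ \sum_{k=0}^{n-1}\frac{(q^{-1};q^2)_k^2\, q^{2k}}{(q^2;q^2)_k^2}\equiv 0 \pmod{[n]\Phi_n(q)}, \qquad \sum_{k=0}^{(n+1)/2}\frac{(q^{-1};q^2)_k^2\, q^{2k}}{(q^2;q^2)_k^2}\equiv 0 \pmod{[n]\Phi_n(q)}. \]
   Context: $(a;q)_k=(1-a)(1-aq)\cdots(1-aq^{k-1})$ (with $(a;q)_0=1$) is the $q$-shifted factorial; $[n]=1+q+\cdots+q^{n-1}$ is the $q$-integer; $\Phi_n(q)$ is the $n$-th cyclotomic polynomial. A congruence of a rational function in $q$ modulo a polynomial $P(q)$, where the denominator is coprime to $P(q)$, means that $P(q)$ divides the numerator (in the ring of Laurent polynomials in $q$ with rational coefficients). *)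

theory Defs
  imports "HOL-Computational_Algebra.Computational_Algebra" Complex_Main
begin

definition qvar :: "rat poly fract" where
  "qvar = to_fract [:0, 1:]"

definition qpochhammer :: "'a::comm_ring_1 \<Rightarrow> 'a \<Rightarrow> nat \<Rightarrow> 'a" where
  "qpochhammer a q k = (\<Prod>j<k. 1 - a * q ^ j)"

definition qint :: "nat \<Rightarrow> rat poly" where
  "qint n = (\<Sum>i<n. [:0, 1:] ^ i)"

definition complex_cyclotomic :: "nat \<Rightarrow> complex poly" where
  "complex_cyclotomic n =
     (\<Prod>k | k \<in> {1..n} \<and> coprime k n. [:- cis (2 * pi * real k / real n), 1:])"

(* The product over the primitive roots of unity has rational coefficients and is
   regarded here as a polynomial over the rationals; see of_rat_cyclotomic below. *)
definition cyclotomic :: "nat \<Rightarrow> rat poly" where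
  "cyclotomic n = (THE p. map_poly of_rat p = complex_cyclotomic n)"

definition laurent_polys :: "rat poly fract set" where
  "laurent_polys = {to_fract a / qvar ^ m | a m. True}"

(* Divisibility is taken inside the ring of Laurent polynomials: in the ambient field
   rat poly fract the relation dvd is trivial. As q is a unit among Laurent polynomials,
   negative powers of q can be kept in the numerator A, so the denominator B is taken to
   be a polynomial. The individual summands of f need not have a denominator coprime to P. *)
definition ratfun_cong :: "rat poly fract \<Rightarrow> rat poly fract \<Rightarrow> rat poly \<Rightarrow> bool" where
  "ratfun_cong f g P \<longleftrightarrow>
     (\<exists>A\<in>laurent_polys. \<exists>B. B \<noteq> 0 \<and> coprime B P \<and> f - g = A / to_fract B \<and>
        (\<exists>C\<in>laurent_polys. A = to_fract P * C))"

lemma prod_complex_cyclotomic: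
  assumes "n > 0"
  shows "(\<Prod>d | d dvd n. complex_cyclotomic d) = monom 1 n - 1"
proof -
  let ?f = "\<lambda>k. [:- cis (2 * pi * real k / real n), 1:]"
  have fin: "finite {d. d dvd n}" using assms by simp
  have dpos: "d > 0" if "d dvd n" for d using that assms by (meson dvd_pos_nat)
  have "(\<Prod>d | d dvd n. complex_cyclotomic d) =
     (\<Prod>(d, j) \<in> Sigma {d. d dvd n} (\<lambda>d. {k. k \<in> {1..d} \<and> coprime k d}).
        [:- cis (2 * pi * real j / real d), 1:])"
    unfolding complex_cyclotomic_def by (rule prod.Sigma) (use fin in auto)
  also have "\<dots> = (\<Prod>k\<in>{1..n}. ?f k)"
  proof (rule prod.reindex_bij_witness[where
        i = "\<lambda>k. (n div gcd k n, k div gcd k n)" and j = "\<lambda>(d, j). j * (n div d)"], goal_cases)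
    case (1 a)
    then obtain d j where a: "a = (d, j)" "d dvd n" "1 \<le> j" "j \<le> d" "coprime j d" by auto
    obtain e where e: "n = d * e" using a by auto
    have pos: "d > 0" "e > 0" using assms e by auto
    have "gcd (j * e) (d * e) = e"
      using a(5) by (simp add: gcd_mult_right coprime_iff_gcd_eq_1 gcd.commute)
    then show ?case using a e pos by simp
  next
    case (2 a)
    then obtain d j where a: "a = (d, j)" "d dvd n" "1 \<le> j" "j \<le> d" "coprime j d" by auto
    obtain e where e: "n = d * e" using a by auto
    have pos: "d > 0" "e > 0" using assms e by auto
    show ?case using a e pos by simp
  next
    case (3 k)
    have "gcd k n dvd k" "gcd k n dvd n" by auto
    then obtain x y where xy: "k = gcd k n * x" "n = gcd k n * y" by (meson dvdE)
    have g: "gcd k n > 0" using assms by simp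
    have "n div gcd k n = y" using xy(2) g by (metis nonzero_mult_div_cancel_left less_numeral_extra(3))
    moreover have "k div gcd k n = x" using xy(1) g by (metis nonzero_mult_div_cancel_left less_numeral_extra(3))
    moreover have "y > 0" using xy(2) assms by (metis gr0I mult_0_right less_numeral_extra(3))
    moreover have "n div y = gcd k n" using xy(2) \<open>y > 0\<close> by (metis nonzero_mult_div_cancel_right less_numeral_extra(3))
    ultimately show ?case using xy(1) by (simp add: mult.commute)
  next
    case (4 k)
    have "gcd k n dvd k" "gcd k n dvd n" by auto
    moreover have "gcd k n > 0" using assms by simp
    moreover have "coprime (k div gcd k n) (n div gcd k n)"
      using assms by (intro div_gcd_coprime) auto
    ultimately show ?case using 4 assms
      by (auto simp: div_le_mono Suc_le_eq div_greater_zero_iff dvd_imp_le intro: div_dvd_iff_mult[THEN iffD2])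
  next
    case (5 a)
    then obtain d j where a: "a = (d, j)" "d dvd n" "1 \<le> j" "j \<le> d" "coprime j d" by auto
    obtain e where e: "n = d * e" using a by auto
    have pos: "d > 0" "e > 0" using assms e by auto
    show ?case using a e pos by (simp add: field_simps)
  qed
  also have "\<dots> = (\<Prod>k<n. ?f k)"
  proof -
    have "(\<Prod>k\<in>{1..n}. ?f k) = (\<Prod>k\<in>{1..<n}. ?f k) * ?f n"
      using assms by (simp add: atLeastLessThanSuc_atLeastAtMost[symmetric])
    also have "?f n = ?f 0" using assms by simp
    also have "(\<Prod>k\<in>{1..<n}. ?f k) * ?f 0 = (\<Prod>k\<in>{0..<n}. ?f k)"
      using assms by (simp add: prod.atLeast_Suc_lessThan mult.commute)
    finally show ?thesis by (simp add: atLeast0LessThan)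
  qed
  also have "\<dots> = monom 1 n - 1"
  proof -
    let ?p = "monom 1 n - 1 :: complex poly"
    let ?Z = "{z::complex. z ^ n = 1}"
    have roots: "{z. poly ?p z = 0} = ?Z" by (simp add: poly_monom)
    have deg: "degree ?p = n"
      using assms by (subst diff_conv_add_uminus, subst degree_add_eq_left) (auto simp: degree_monom_eq)
    have lc: "lead_coeff ?p = 1" using assms by (simp add: deg)
    have "(\<Prod>k<n. ?f k) = (\<Prod>z\<in>?Z. [:- z, 1:])"
      by (rule prod.reindex_bij_betw[OF bij_betw_roots_unity[OF assms]])
    also have "\<dots> = ?p"
    proof -
      have "rsquarefree ?p"
      proof (rule rsquarefree_roots[THEN iffD2], intro allI notI)
        fix a assume a: "poly ?p a = 0 \<and> poly (pderiv ?p) a = 0"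
        then have "a ^ n = 1" "of_nat n * a ^ (n - 1) = 0"
          by (auto simp: poly_monom pderiv_diff pderiv_monom)
        then show False using assms by (auto simp: power_0_left)
      qed
      then show ?thesis using complex_poly_decompose_rsquarefree[of ?p] lc roots by simp
    qed
    finally show ?thesis .
  qed
  finally show ?thesis .
qed

lemma of_rat_poly_mult:
  "map_poly (of_rat :: rat \<Rightarrow> complex) (p * q) = map_poly of_rat p * map_poly of_rat q"
  by (rule poly_eqI) (simp add: coeff_map_poly coeff_mult of_rat_sum of_rat_mult)

lemma of_rat_poly_diff:
  "map_poly (of_rat :: rat \<Rightarrow> complex) (p - q) = map_poly of_rat p - map_poly of_rat q"
  by (rule poly_eqI) (simp add: coeff_map_poly of_rat_diff)

lemma of_rat_poly_prod:
  "map_poly (of_rat :: rat \<Rightarrow> complex) (\<Prod>x\<in>A. f x) = (\<Prod>x\<in>A. map_poly of_rat (f x))"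
  by (induction A rule: infinite_finite_induct) (auto simp: of_rat_poly_mult map_poly_1)

lemma of_rat_poly_inj:
  "map_poly (of_rat :: rat \<Rightarrow> complex) p = map_poly of_rat q \<longleftrightarrow> p = q"
  by (auto simp: poly_eq_iff coeff_map_poly)

lemma complex_cyclotomic_rational:
  "n > 0 \<Longrightarrow> \<exists>p. map_poly of_rat p = complex_cyclotomic n"
proof (induction n rule: less_induct)
  case (less n)
  let ?h = "map_poly (of_rat :: rat \<Rightarrow> complex)"
  let ?D = "{d. d dvd n} - {n}"
  have "\<forall>d\<in>?D. \<exists>p. ?h p = complex_cyclotomic d"
    using less by (metis (no_types, lifting) DiffE dvd_imp_le dvd_pos_nat insertI1 mem_Collect_eq nat_less_le)
  then obtain F where F: "\<forall>d\<in>?D. ?h (F d) = complex_cyclotomic d" by metis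
  define b where "b = (\<Prod>d\<in>?D. F d)"
  define a :: "rat poly" where "a = monom 1 n - 1"
  have hb: "?h b = (\<Prod>d\<in>?D. complex_cyclotomic d)"
    unfolding b_def of_rat_poly_prod using F by (intro prod.cong) auto
  have ha: "?h a = complex_cyclotomic n * ?h b"
  proof -
    have "?h a = monom 1 n - 1" by (simp add: a_def of_rat_poly_diff map_poly_monom map_poly_1 flip: one_pCons)
    also have "\<dots> = (\<Prod>d | d dvd n. complex_cyclotomic d)"
      using prod_complex_cyclotomic less.prems by simp
    also have "\<dots> = complex_cyclotomic n * (\<Prod>d\<in>?D. complex_cyclotomic d)"
      using less.prems by (intro prod.remove) auto
    finally show ?thesis using hb by simp
  qed
  have degh: "degree (?h p) = degree p" for p by (rule degree_map_poly) auto
  have b0: "b \<noteq> 0"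
  proof
    assume "b = 0"
    then have "a = 0" using ha of_rat_poly_inj[of a 0] by simp
    then have "coeff a n = 0" by simp
    then show False using less.prems by (simp add: a_def)
  qed
  have "?h (a mod b) = ?h (a - a div b * b)" by (simp add: minus_div_mult_eq_mod)
  also have "\<dots> = (complex_cyclotomic n - ?h (a div b)) * ?h b"
    by (simp add: of_rat_poly_diff of_rat_poly_mult ha algebra_simps)
  finally have eq: "?h (a mod b) = (complex_cyclotomic n - ?h (a div b)) * ?h b" .
  have hb0: "?h b \<noteq> 0" using b0 of_rat_poly_inj[of b 0] by simp
  have "complex_cyclotomic n - ?h (a div b) = 0"
  proof (rule ccontr)
    assume ne: "complex_cyclotomic n - ?h (a div b) \<noteq> 0"
    then have "degree (?h (a mod b)) \<ge> degree (?h b)"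
      unfolding eq using hb0 by (simp add: degree_mult_eq)
    then have "degree (a mod b) \<ge> degree b" by (simp add: degh)
    moreover have "a mod b \<noteq> 0" using eq ne hb0 by auto
    ultimately show False using degree_mod_less[OF b0, of a] by auto
  qed
  then show ?case by (metis eq_iff_diff_eq_0)
qed

lemma of_rat_cyclotomic:
  assumes "n > 0"
  shows "map_poly of_rat (cyclotomic n) = complex_cyclotomic n"
proof -
  obtain p where p: "map_poly of_rat p = complex_cyclotomic n"
    using complex_cyclotomic_rational[OF assms] by blast
  then have "cyclotomic n = p" unfolding cyclotomic_def
    by (intro the_equality) (auto simp: of_rat_poly_inj simp flip: p)
  then show ?thesis using p by simp
qed

end

theory Submission
  imports Defs "HOL-Computational_Algebra.Field_as_Ring"
begin

text \<open>
  Each sum is Gosper summable: with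
  \<open>r m = (q;q\<^sup>2)\<^sub>m / (q\<^sup>2;q\<^sup>2)\<^sub>m\<close> the sum up to \<open>m\<close> equals
  \<open>([2m] + [2m+1]) r(m)\<^sup>2\<close>. Moreover \<open>r m\<close> is the central \<open>q\<close>-binomial coefficient
  divided by \<open>(-q;q)\<^sub>m\<^sup>2\<close>. For odd \<open>n\<close> the factors \<open>1 + q\<^sup>j\<close> are coprime to \<open>[n]\<close>, while for
  \<open>m = n - 1\<close> and for \<open>m = (n+1)/2\<close> the central \<open>q\<close>-binomial coefficient is divisible by \<open>[n]\<close>.
  Hence both sums are divisible even by \<open>[n]\<^sup>2\<close>, of which \<open>[n] \<Phi>\<^sub>n(q)\<close> is a divisor.
\<close>

section \<open>q-integers and q-factorials as polynomials in q = \<open>X\<close>\<close>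

abbreviation X :: "rat poly" where "X \<equiv> [:0, 1:]"

definition qfact :: "nat \<Rightarrow> rat poly" where
  "qfact n = (\<Prod>i<n. qint (Suc i))"

lemma qint_0 [simp]: "qint 0 = 0"
  by (simp add: qint_def)

lemma qint_Suc: "qint (Suc n) = qint n + X ^ n"
  by (simp add: qint_def)

lemma qint_1 [simp]: "qint (Suc 0) = 1"
  by (simp add: qint_Suc)

lemma qint_add: "qint (m + n) = qint m + X ^ m * qint n"
  by (induction n) (simp_all add: qint_Suc algebra_simps power_add)

lemma one_minus_X_mult_qint: "(1 - X) * qint n = 1 - X ^ n"
  unfolding qint_def by (rule one_diff_power_eq[symmetric])

text \<open>By degrees. In other words, q is not a root of unity, which is what the closed form of
  the sum asks of its base.\<close>

lemma X_power_eq_1_iff: "X ^ n = 1 \<longleftrightarrow> n = 0"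
proof -
  have "degree (X ^ n) = n"
    by (simp add: degree_power_eq)
  then show ?thesis
    by (metis degree_1 power_0)
qed

lemma qint_eq_0_iff [simp]: "qint n = 0 \<longleftrightarrow> n = 0"
  using one_minus_X_mult_qint[of n] X_power_eq_1_iff[of n] by auto

lemma qfact_0 [simp]: "qfact 0 = 1"
  by (simp add: qfact_def)

lemma qfact_Suc: "qfact (Suc n) = qint (Suc n) * qfact n"
  by (simp add: qfact_def mult.commute)

lemma qfact_nonzero [simp]: "qfact n \<noteq> 0"
  by (simp add: qfact_def)

text \<open>By the recursion \<open>[m+n] = [m] + q\<^sup>m [n]\<close>, which is the \<open>q\<close>-Pascal rule.\<close>
lemma qfact_mult_dvd_qfact_add: "qfact m * qfact n dvd qfact (m + n)"
proof (induction "m + n" arbitrary: m n)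
  case 0
  then show ?case by simp
next
  case (Suc s)
  show ?case
  proof (cases "m = 0 \<or> n = 0")
    case True
    then show ?thesis by auto
  next
    case False
    then obtain a b where ab: "m = Suc a" "n = Suc b"
      by (meson not0_implies_Suc)
    \<comment> \<open>Induction on the sum lets either index drop by one, as both terms of the
      Pascal rule require.\<close>
    have s: "s = a + n" "s = m + b"
      using Suc.hyps(2) ab by simp_all
    have "qfact a * qfact n dvd qfact s" "qfact m * qfact b dvd qfact s"
      using Suc.hyps(1)[of a n] Suc.hyps(1)[of m b] s by auto
    then have "qint m * (qfact a * qfact n) dvd qint m * qfact s"
      and "qint n * (qfact m * qfact b) dvd qint n * qfact s"
      by (simp_all only: mult_dvd_mono dvd_refl)
    then have "qfact m * qfact n dvd qint m * qfact s"
      and "qfact m * qfact n dvd qint n * qfact s"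
      by (simp_all only: ab qfact_Suc ac_simps)
    then have "qfact m * qfact n dvd qint m * qfact s + X ^ m * (qint n * qfact s)"
      by (simp only: dvd_add dvd_mult)
    also have "\<dots> = qfact (m + n)"
      using Suc.hyps(2) by (metis qfact_Suc qint_add distrib_right mult.assoc)
    finally show ?thesis .
  qed
qed

section \<open>Coprimality and divisors of [n]\<close>

lemma coprime_qint_odd_qint: "coprime (qint (2 * k + 1)) (qint (k + 1))"
proof (rule coprimeI)
  fix c
  assume c: "c dvd qint (2 * k + 1)" "c dvd qint (k + 1)"
  \<comment> \<open>Two steps of Euclid's algorithm: from [2k+1] and [k+1] to [k], then to
    1.\<close>
  have "qint (2 * k + 1) = qint k + X ^ k * qint (k + 1)"
    using qint_add[of k "k + 1"] by (simp add: mult_2)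
  with c have "c dvd qint k"
    by (metis dvd_add_left_iff dvd_mult)
  moreover have "qint (k + 1) = 1 + X * qint k"
    using qint_add[of 1 k] by simp
  ultimately show "is_unit c"
    using c(2) by (metis dvd_add_left_iff dvd_mult)
qed

text \<open>Modulo a common divisor, q^(jn) is -1 because n is odd, and 1 because [n] divides q^n -
  1. The divisor therefore divides 2, a unit over the rationals.\<close>

lemma coprime_one_plus_X_power_qint:
  assumes "odd n"
  shows "coprime (1 + X ^ j) (qint n)"
proof (rule coprimeI)
  fix c
  assume c: "c dvd 1 + X ^ j" "c dvd qint n"
  have diff_dvd: "x - y dvd x ^ k - y ^ k" for x y :: "rat poly" and k
    unfolding power_diff_sumr2 by simp
  have "1 + X ^ j dvd (X ^ j) ^ n + 1"
    using diff_dvd[of "X ^ j" "-1" n] power_minus_odd[OF assms, of "1 :: rat poly"]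
    by (simp only: power_one diff_minus_eq_add add.commute)
  with c(1) have plus: "c dvd (X ^ j) ^ n + 1"
    by (rule dvd_trans)
  have "c dvd (1 - X) * qint n"
    using c(2) by (rule dvd_mult)
  then have "c dvd X ^ n - 1"
    by (simp only: one_minus_X_mult_qint dvd_diff_commute)
  moreover have "X ^ n - 1 dvd (X ^ j) ^ n - 1"
    using diff_dvd[of "X ^ n" 1 j] by (simp only: power_one mult.commute flip: power_mult)
  ultimately have "c dvd (X ^ j) ^ n - 1"
    by (rule dvd_trans)
  with plus have "c dvd ((X ^ j) ^ n + 1) - ((X ^ j) ^ n - 1)"
    by (rule dvd_diff)
  then have "c dvd [:2:]"
    by (simp add: numeral_poly)
  moreover have "is_unit [:2 :: rat:]"
    unfolding is_unit_const_poly_iff by (simp add: dvd_field_iff)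
  ultimately show "is_unit c"
    by (rule dvd_trans)
qed

text \<open>The cyclotomic polynomials of the divisors of n multiply to q^n - 1 = (q - 1)[n]. As n >
  1, the factors for 1 and n are distinct, and the first one, q - 1, cancels.\<close>

lemma cyclotomic_dvd_qint:
  assumes "n > 1"
  shows "cyclotomic n dvd qint n"
proof -
  have X_power: "X ^ n = monom 1 n"
    by (simp add: monom_altdef)
  have "map_poly of_rat (\<Prod>d | d dvd n. cyclotomic d) = (\<Prod>d | d dvd n. complex_cyclotomic d)"
    unfolding of_rat_poly_prod using assms
    by (intro prod.cong refl of_rat_cyclotomic) (auto intro: Nat.gr0I)
  also have "\<dots> = monom 1 n - 1"
    using assms by (simp add: prod_complex_cyclotomic)
  also have "\<dots> = map_poly of_rat (X ^ n - 1)"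
    unfolding X_power
    by (simp add: of_rat_poly_diff map_poly_monom map_poly_1) (simp add: one_pCons)
  finally have prod: "(\<Prod>d | d dvd n. cyclotomic d) = X ^ n - 1"
    by (simp add: of_rat_poly_inj)
  have "map_poly complex_of_rat (cyclotomic 1) = map_poly of_rat (X - 1)"
  proof -
    have "{k::nat. k \<in> {1..1} \<and> coprime k 1} = {1}" by auto
    then have "complex_cyclotomic 1 = map_poly of_rat (X - 1)"
      by (simp add: complex_cyclotomic_def map_poly_pCons one_pCons)
    then show ?thesis
      by (simp only: of_rat_cyclotomic zero_less_one)
  qed
  then have c1: "cyclotomic 1 = X - 1"
    by (simp only: of_rat_poly_inj)
  have "cyclotomic 1 * cyclotomic n = (\<Prod>d\<in>{1, n}. cyclotomic d)"
    using assms by simp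
  also have "\<dots> dvd (\<Prod>d | d dvd n. cyclotomic d)"
    using assms by (intro prod_dvd_prod_subset) auto
  also have "\<dots> = (X - 1) * qint n"
    using prod one_minus_X_mult_qint[of n] by (simp add: algebra_simps)
  finally have "(X - 1) * cyclotomic n dvd (X - 1) * qint n"
    by (simp only: c1)
  moreover have "X - 1 \<noteq> 0"
    using X_power_eq_1_iff[of 1] by simp
  ultimately show ?thesis
    by (simp only: dvd_mult_cancel_left) simp
qed

section \<open>q-shifted factorials and the closed form of the sum\<close>

lemma qint_double: "qint (2 * n) = (1 + X ^ n) * qint n"
  using qint_add[of n n] by (simp only: mult_2 distrib_right mult_1)

text \<open>The factorization
  \<open>(q;q\<^sup>2)\<^sub>m / (q\<^sup>2;q\<^sup>2)\<^sub>m = [2m]! / ([m]! (-q;q)\<^sub>m)\<^sup>2\<close>, cleared of denominators.\<close>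
lemma pochhammer_ratio_qfact:
  "qpochhammer X (X ^ 2) m * (qfact m * qfact m * (\<Prod>j<m. 1 + X ^ Suc j) ^ 2)
     = qpochhammer (X ^ 2) (X ^ 2) m * qfact (2 * m)"
proof (induction m)
  case 0
  then show ?case by (simp add: qpochhammer_def)
next
  case (Suc m)
  let ?A = "qpochhammer X (X ^ 2)" and ?B = "qpochhammer (X ^ 2) (X ^ 2)"
  let ?D = "\<lambda>m. \<Prod>j<m. 1 + X ^ Suc j"
  let ?u = "qint (Suc m)" and ?v = "qint (2 * m + 1)" and ?w = "1 + X ^ Suc m"
  \<comment> \<open>Both new factors contain 1 - q, so passing to m + 1 multiplies the ratio by
    [2m+1] / ((1 + q^(m+1)) [m+1]).\<close>
  have "?A (Suc m) = ?A m * (1 - X ^ (2 * m + 1))"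
    by (simp add: qpochhammer_def power_mult)
  then have A: "?A (Suc m) = ?A m * ((1 - X) * ?v)"
    by (simp only: one_minus_X_mult_qint)
  have "?B (Suc m) = ?B m * (1 - X ^ (2 * Suc m))"
    by (simp add: qpochhammer_def power_mult power2_eq_square mult.assoc)
  then have B: "?B (Suc m) = ?B m * ((1 - X) * (?w * ?u))"
    by (simp only: one_minus_X_mult_qint flip: qint_double)
  have F: "qfact (2 * Suc m) = ?w * ?u * ?v * qfact (2 * m)"
    using qint_double[of "Suc m"] by (simp add: qfact_Suc mult.assoc)
  have D: "?D (Suc m) = ?D m * ?w"
    by simp
  have "?A (Suc m) * (qfact (Suc m) * qfact (Suc m) * ?D (Suc m) ^ 2)
     = (1 - X) * ?v * ?u * ?u * ?w ^ 2 * (?A m * (qfact m * qfact m * ?D m ^ 2))"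
    unfolding A D qfact_Suc by (simp only: power_mult_distrib ac_simps)
  also have "\<dots> = (1 - X) * ?v * ?u * ?u * ?w ^ 2 * (?B m * qfact (2 * m))"
    by (simp only: Suc.IH)
  also have "\<dots> = ?B (Suc m) * qfact (2 * Suc m)"
    unfolding B F by (simp only: power2_eq_square ac_simps)
  finally show ?case .
qed

text \<open>Stated over integral domains to serve both the polynomial \<open>X\<close> and elements
  of a field.\<close>

lemma qpochhammer_square_nonzero:
  fixes q :: "'a::idom"
  assumes "\<And>k. k > 0 \<Longrightarrow> q ^ k \<noteq> 1"
  shows "qpochhammer (q^2) (q^2) m \<noteq> 0"
proof -
  have "q ^ 2 * (q ^ 2) ^ j \<noteq> 1" for j
    using assms[of "2 + 2 * j"] unfolding power_add power_mult by simp
  then show ?thesis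
    by (simp add: qpochhammer_def)
qed

text \<open>Found by Gosper's algorithm. It terminates because the parameters \<open>a = b = q\<^sup>-\<^sup>1\<close> of the
  basic hypergeometric series with base \<open>q\<^sup>2\<close> satisfy \<open>a b q\<^sup>2 = 1\<close>.\<close>
lemma sum_qpochhammer_closed_form:
  fixes q :: "'a::field"
  assumes q: "q \<noteq> 0" and not_root: "\<And>k. k > 0 \<Longrightarrow> q ^ k \<noteq> 1"
  shows "(q - 1) * (\<Sum>k=0..m. (qpochhammer (inverse q) (q^2) k)^2 * q^(2*k)
             / (qpochhammer (q^2) (q^2) k)^2)
         = ((1 + q) * q ^ (2 * m) - 2) * (qpochhammer q (q^2) m / qpochhammer (q^2) (q^2) m)^2"
proof (induction m)
  case 0
  then show ?case by (simp add: qpochhammer_def)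
next
  case (Suc m)
  let ?A = "qpochhammer q (q^2)" and ?B = "qpochhammer (q^2) (q^2)"
  define y where "y = (q ^ 2) ^ m"
  define A where "A = ?A m"
  define B where "B = ?B m"
  have y: "q ^ (2 * m) = y"
    by (simp only: y_def power_mult)
  have B0: "B \<noteq> 0"
    unfolding B_def using not_root by (rule qpochhammer_square_nonzero)
  have y0: "1 - y * q ^ 2 \<noteq> 0"
    using not_root[of "2 * m + 2"] unfolding power_add y by simp
  have A': "?A (Suc m) = A * (1 - y * q)"
    by (simp add: qpochhammer_def A_def y_def mult.commute)
  have B': "?B (Suc m) = B * (1 - y * q ^ 2)"
    by (simp add: qpochhammer_def B_def y_def mult.commute)
  \<comment> \<open>Splitting off the first factor shifts the parameter from 1/q to q, which brings
    in \<open>?A\<close>.\<close>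
  have P: "qpochhammer (inverse q) (q^2) (Suc m) = (1 - inverse q) * A"
    unfolding qpochhammer_def A_def using q
    by (subst prod.lessThan_Suc_shift) (simp add: power2_eq_square field_simps)
  have y': "q ^ (2 * Suc m) = y * q ^ 2"
    by (simp add: power2_eq_square flip: y)
  \<comment> \<open>The induction step with denominators and the common factor \<open>A ^ 2\<close>
    removed. The cube is q - 1 times the square from \<open>sq\<close>.\<close>
  have key: "((1 + q) * y - 2) * (1 - y * q ^ 2) ^ 2 + (q - 1) ^ 3 * y
     = ((1 + q) * (y * q ^ 2) - 2) * (1 - y * q) ^ 2"
    by algebra
  have sq: "(1 - inverse q) ^ 2 * q ^ 2 = (q - 1) ^ 2"
    using q by (simp add: field_simps flip: power_mult_distrib)
  have "(q - 1) * (((1 - inverse q) * A) ^ 2 * (y * q ^ 2) / (B * (1 - y * q ^ 2)) ^ 2)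
      = (q - 1) * ((1 - inverse q) ^ 2 * q ^ 2) * y * A ^ 2 / (B * (1 - y * q ^ 2)) ^ 2"
    by (simp add: power_mult_distrib ac_simps)
  also have "\<dots> = (q - 1) ^ 3 * y * A ^ 2 / (B * (1 - y * q ^ 2)) ^ 2"
    by (simp only: sq) (simp add: power2_eq_square power3_eq_cube ac_simps)
  finally have new: "(q - 1) * (((1 - inverse q) * A) ^ 2 * (y * q ^ 2) / (B * (1 - y * q ^ 2)) ^ 2)
      = (q - 1) ^ 3 * y * A ^ 2 / (B * (1 - y * q ^ 2)) ^ 2" .
  have old: "((1 + q) * y - 2) * (A / B) ^ 2
      = ((1 + q) * y - 2) * (1 - y * q ^ 2) ^ 2 * A ^ 2 / (B * (1 - y * q ^ 2)) ^ 2"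
    using B0 y0 by (simp add: power_mult_distrib power_divide)
  have "((1 + q) * y - 2) * (A / B) ^ 2 + (q - 1) ^ 3 * y * A ^ 2 / (B * (1 - y * q ^ 2)) ^ 2
     = (((1 + q) * y - 2) * (1 - y * q ^ 2) ^ 2 + (q - 1) ^ 3 * y) * A ^ 2
         / (B * (1 - y * q ^ 2)) ^ 2"
    unfolding old by (simp only: add_divide_distrib distrib_right)
  also have "\<dots> = ((1 + q) * (y * q ^ 2) - 2) * (A * (1 - y * q) / (B * (1 - y * q ^ 2))) ^ 2"
    unfolding key by (simp add: power_mult_distrib power_divide ac_simps)
  finally show ?case
    using Suc.IH unfolding sum.atLeast0_atMost_Suc distrib_left P A' B' y' new
    by (simp only: A_def B_def y)
qed

section \<open>Transfer to rational functions\<close>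

lemma to_fract_prod: "to_fract (\<Prod>i\<in>A. f i) = (\<Prod>i\<in>A. to_fract (f i))"
  by (induction A rule: infinite_finite_induct) simp_all

lemma to_fract_power: "to_fract (a ^ n) = to_fract a ^ n"
  by (induction n) simp_all

lemma to_fract_qpochhammer:
  "to_fract (qpochhammer a q k) = qpochhammer (to_fract a) (to_fract q) k"
  by (simp add: qpochhammer_def to_fract_prod to_fract_power)

text \<open>Reduces both congruences to the divisibility of the central q-binomial coefficient
  \<open>G\<close> by [n]: the sum is ([2m] + [2m+1]) G^2 / (-q;q)_m^4, with denominator prime to
  [n].\<close>

lemma ratfun_cong_sum_of_qint_dvd:
  assumes n: "n > 1" "odd n"
    and G: "qfact (2 * m) = G * (qfact m * qfact m)" and dvd: "qint n dvd G"
  shows "ratfun_cong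
           (\<Sum>k=0..m. (qpochhammer (inverse qvar) (qvar^2) k)^2 * qvar^(2*k)
              / (qpochhammer (qvar^2) (qvar^2) k)^2)
           0 (qint n * cyclotomic n)" (is "ratfun_cong ?S 0 ?P")
proof -
  let ?D = "\<Prod>j<m. 1 + X ^ Suc j"
  let ?N = "(qint (2 * m) + qint (2 * m + 1)) * G ^ 2"
  have Pn: "?P dvd qint n ^ 2"
    unfolding power2_eq_square using cyclotomic_dvd_qint[OF n(1)] by (intro mult_dvd_mono) auto
  have "?P dvd G ^ 2"
    using Pn dvd_power_same[OF dvd, of 2] by (rule dvd_trans)
  then obtain C where C: "?N = ?P * C"
    by (meson dvd_def dvd_mult)
  have "coprime ?D (qint n)"
    by (rule prod_coprime_left) (rule coprime_one_plus_X_power_qint[OF n(2)])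
  then have "coprime ((?D ^ 2) ^ 2) (qint n ^ 2)"
    by simp
  then have cop: "coprime ((?D ^ 2) ^ 2) ?P"
    by (rule coprime_divisors[OF dvd_refl Pn])
  have B0: "qpochhammer (X ^ 2) (X ^ 2) m \<noteq> 0"
    by (rule qpochhammer_square_nonzero) (simp add: X_power_eq_1_iff)
  have "1 + X ^ Suc j \<noteq> 0" for j
  proof
    assume "1 + X ^ Suc j = 0"
    \<comment> \<open>The value at q = 1 is 2.\<close>
    then have "poly (1 + X ^ Suc j) 1 = 0"
      by (simp only: poly_0)
    then show False
      by simp
  qed
  then have D0: "?D \<noteq> 0"
    by simp
  have "qpochhammer X (X ^ 2) m * ?D ^ 2 = qpochhammer (X ^ 2) (X ^ 2) m * G"
    using pochhammer_ratio_qfact[of m] unfolding G by (simp add: algebra_simps)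
  then have "to_fract (qpochhammer X (X ^ 2) m) * to_fract (?D ^ 2)
      = to_fract (qpochhammer (X ^ 2) (X ^ 2) m) * to_fract G"
    by (simp only: flip: to_fract_mult)
  then have r: "qpochhammer qvar (qvar ^ 2) m / qpochhammer (qvar ^ 2) (qvar ^ 2) m
      = to_fract G / to_fract (?D ^ 2)"
    using B0 D0 unfolding qvar_def
    by (simp add: frac_eq_eq mult.commute flip: to_fract_qpochhammer to_fract_power)
  have q0: "qvar \<noteq> 0"
    by (simp add: qvar_def)
  have q1: "qvar ^ k \<noteq> 1" if "k > 0" for k
    using that X_power_eq_1_iff[of k] unfolding qvar_def
    by (metis less_numeral_extra(3) to_fract_1 to_fract_eq_iff to_fract_power)
  \<comment> \<open>With x = q and y = q^(2m), the left side is -(1 - y) - (1 - yx); this exposes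
    the factor q - 1 that cancels from the closed form.\<close>
  have "(1 + x) * y - 2 = (x - 1) * (a + b)"
    if "(1 - x) * a = 1 - y" "(1 - x) * b = 1 - y * x" for x y a b :: "rat poly"
    using that by algebra
  then have "(1 + X) * X ^ (2 * m) - 2 = (X - 1) * (qint (2 * m) + qint (2 * m + 1))"
    by this (simp_all only: one_minus_X_mult_qint power_add power_one_right)
  then have "to_fract ((1 + X) * X ^ (2 * m) - 2)
     = to_fract ((X - 1) * (qint (2 * m) + qint (2 * m + 1)))"
    by (rule arg_cong)
  moreover have two: "to_fract (2 :: rat poly) = 2"
    by (metis one_add_one to_fract_1 to_fract_add)
  ultimately have lin: "(1 + qvar) * qvar ^ (2 * m) - 2
     = (qvar - 1) * to_fract (qint (2 * m) + qint (2 * m + 1))"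
    unfolding to_fract_diff to_fract_mult two by (simp only: to_fract_add to_fract_mult
        to_fract_diff to_fract_power to_fract_1 flip: qvar_def)
  have "(qvar - 1) * ?S = (qvar - 1) * (to_fract (qint (2 * m) + qint (2 * m + 1))
      * (to_fract G / to_fract (?D ^ 2)) ^ 2)"
    using sum_qpochhammer_closed_form[OF q0 q1, of m] unfolding r lin by (simp only: mult.assoc)
  moreover have "qvar - 1 \<noteq> 0"
    using q1[of 1] by simp
  ultimately have "?S = to_fract (qint (2 * m) + qint (2 * m + 1))
      * (to_fract G / to_fract (?D ^ 2)) ^ 2"
    by (rule mult_left_cancel[THEN iffD1, rotated])
  also have "\<dots> = to_fract ?N / to_fract ((?D ^ 2) ^ 2)"
    by (simp only: power_divide to_fract_mult to_fract_power times_divide_eq_right)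
  finally have S: "?S - 0 = to_fract ?N / to_fract ((?D ^ 2) ^ 2)"
    by simp
  have laurent: "to_fract a \<in> laurent_polys" for a
    unfolding laurent_polys_def by (rule CollectI, rule exI[of _ a], rule exI[of _ 0]) simp
  show ?thesis
    unfolding ratfun_cong_def
  proof (intro bexI exI conjI)
    show "(?D ^ 2) ^ 2 \<noteq> 0"
      using D0 by simp
    show "to_fract ?N = to_fract ?P * to_fract C"
      by (simp only: C to_fract_mult)
  qed (fact cop S laurent)+
qed

section \<open>The two truncations\<close>

theorem theorem1p2:
  fixes n :: nat
  assumes "n > 1" and "odd n"
  shows "ratfun_cong
           (\<Sum>k=0..n-1. (qpochhammer (inverse qvar) (qvar^2) k)^2 * qvar^(2*k)
              / (qpochhammer (qvar^2) (qvar^2) k)^2)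
           0 (qint n * cyclotomic n)
       \<and> ratfun_cong
           (\<Sum>k=0..(n+1) div 2. (qpochhammer (inverse qvar) (qvar^2) k)^2 * qvar^(2*k)
              / (qpochhammer (qvar^2) (qvar^2) k)^2)
           0 (qint n * cyclotomic n)"
proof
  have central: "\<exists>G. qfact (2 * m) = G * (qfact m * qfact m)" for m
    using qfact_mult_dvd_qfact_add[of m m] by (metis dvdE mult.commute mult_2)
  show "ratfun_cong
           (\<Sum>k=0..n-1. (qpochhammer (inverse qvar) (qvar^2) k)^2 * qvar^(2*k)
              / (qpochhammer (qvar^2) (qvar^2) k)^2)
           0 (qint n * cyclotomic n)"
  proof -
    define k where "k = n - 1"
    have k: "n = Suc k"
      using assms by (simp add: k_def)
    obtain G where G: "qfact (2 * k) = G * (qfact k * qfact k)"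
      using central by blast
    \<comment> \<open>\<open>H\<close> is the q-binomial coefficient of 2k+1 over k. Two
      factorizations of [2k+1]! give [2k+1] G = [n] H, and here [n] = [k+1] is prime to
      [2k+1].\<close>
    obtain H where "qfact (n + k) = qfact n * qfact k * H"
      using qfact_mult_dvd_qfact_add by blast
    moreover have "qfact (n + k) = qint (2 * k + 1) * qfact (2 * k)"
      by (simp add: k qfact_Suc mult_2)
    ultimately have "(qint (2 * k + 1) * G) * (qfact k * qfact k) = (qint n * H) * (qfact k * qfact k)"
      unfolding G k qfact_Suc by (simp only: ac_simps)
    then have "qint (2 * k + 1) * G = qint n * H"
      by simp
    then have "qint n dvd qint (2 * k + 1) * G"
      by simp
    moreover have "coprime (qint n) (qint (2 * k + 1))"
      using coprime_qint_odd_qint[of k] by (simp add: k coprime_commute)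
    ultimately have "qint n dvd G"
      by (simp only: coprime_dvd_mult_right_iff)
    then show ?thesis
      using ratfun_cong_sum_of_qint_dvd[OF assms G] by (simp add: k_def)
  qed
  show "ratfun_cong
           (\<Sum>k=0..(n+1) div 2. (qpochhammer (inverse qvar) (qvar^2) k)^2 * qvar^(2*k)
              / (qpochhammer (qvar^2) (qvar^2) k)^2)
           0 (qint n * cyclotomic n)"
  proof -
    obtain k where k: "n = 2 * k + 1"
      using assms(2) by (rule oddE)
    then have m: "(n + 1) div 2 = Suc k"
      by simp
    obtain G where G: "qfact (2 * Suc k) = G * (qfact (Suc k) * qfact (Suc k))"
      using central by blast
    \<comment> \<open>Comparing the central coefficients at k + 1 and k gives [k+1]^2 G = [n] [2k+2]
      H. The same coprimality applies with [n] = [2k+1] in the other role.\<close>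
    obtain H where H: "qfact (2 * k) = H * (qfact k * qfact k)"
      using central by blast
    have "qfact (2 * Suc k) = qint (2 * Suc k) * (qint n * qfact (2 * k))"
      by (simp add: k qfact_Suc)
    then have "(qint (Suc k) ^ 2 * G) * (qfact k * qfact k)
        = (qint n * (qint (2 * Suc k) * H)) * (qfact k * qfact k)"
      unfolding G H qfact_Suc power2_eq_square by (simp only: ac_simps)
    then have "qint (Suc k) ^ 2 * G = qint n * (qint (2 * Suc k) * H)"
      by simp
    then have "qint n dvd qint (Suc k) ^ 2 * G"
      by simp
    moreover have "coprime (qint n) (qint (Suc k) ^ 2)"
      using coprime_qint_odd_qint[of k] by (simp add: k)
    ultimately have "qint n dvd G"
      by (simp only: coprime_dvd_mult_right_iff)
    then show ?thesis
      using ratfun_cong_sum_of_qint_dvd[OF assms G] by (simp only: m)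
  qed
qed

end
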